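(* Let $K\subset\mathbb{C}$ be bounded and convex with diameter $s$, and let $k$ and $n$ be positive integers with $k<n$ and such that $\sqrt{k}>4(n-k)$. Let $\epsilon$ be a positive real number. If $$\epsilon>\frac{4s(n-k)}{\sqrt{k}-4(n-k)},$$ then $K$ satisfies $\mathcal{RAGL}(n,k,\epsilon)$.
   Context: For a rational function $f\in\mathbb{C}(z)$ and a set $G\subset\mathbb{C}$, let $\#_z(f,G)$, $\#_p(f,G)$ and $\#_c(f,G)$ denote respectively the number of zeros, poles and critical points of $f$ lying in $G$, all counted with multiplicity; the critical points of $f$ are the zeros in $\mathbb{C}$ of the derivative $f'$. For $\epsilon>0$, $K_\epsilon=\{z\in\mathbb{C}: \inf_{w\in K}|z-w|<\epsilon\}$ denotes the $\epsilon$-neighborhood of $K$. Property $\mathcal{RAGL}(n,k,\epsilon)$ (rational approximate Gauss--Lucas property) of a set $K$: for every rational function $f\in\mathbb{C}(z)$ with $\#_z(f,\mathbb{C})+\#_p(f,\mathbb{C})=n$, if $\#_z(f,K)\geq k$ then $\#_c(f,K_\epsilon)\geq k-1$. *)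

theory Defs
  imports
    "HOL-Analysis.Analysis"
    "HOL-Computational_Algebra.Computational_Algebra"
    "HOL-Computational_Algebra.Field_as_Ring"
begin

(* The field C(z) of rational functions is rendered as the fraction field of C[z]. *)
type_synonym ratfun = "complex poly fract"

definition rf_num :: "ratfun \<Rightarrow> complex poly" where
  "rf_num f = fst (quot_of_fract f)"

definition rf_den :: "ratfun \<Rightarrow> complex poly" where
  "rf_den f = snd (quot_of_fract f)"

(* quot_of_fract yields the representation in lowest terms, so no cancelling factors are
   counted below. *)
lemma rf_lowest_terms:
  "f = Fract (rf_num f) (rf_den f)" "coprime (rf_num f) (rf_den f)" "rf_den f \<noteq> 0"
proof -
  show "f = Fract (rf_num f) (rf_den f)"
    using quot_to_fract_quot_of_fract[of f]
    by (simp add: rf_num_def rf_den_def quot_to_fract_def case_prod_unfold)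
  show "coprime (rf_num f) (rf_den f)"
    by (simp add: rf_num_def rf_den_def coprime_quot_of_fract)
  show "rf_den f \<noteq> 0"
    by (simp add: rf_den_def)
qed

definition rf_deriv :: "ratfun \<Rightarrow> ratfun" where
  "rf_deriv f =
     Fract (pderiv (rf_num f) * rf_den f - rf_num f * pderiv (rf_den f)) ((rf_den f)\<^sup>2)"

(* The quotient rule holds for every representation, not only the reduced one. *)
lemma rf_deriv_Fract:
  assumes "q \<noteq> 0"
  shows "rf_deriv (Fract p q) = Fract (pderiv p * q - p * pderiv q) (q\<^sup>2)"
proof -
  define r s where "r = rf_num (Fract p q)" and "s = rf_den (Fract p q)"
  have nz: "s \<noteq> 0" and "Fract p q = Fract r s"
    using rf_lowest_terms[of "Fract p q"] by (simp_all add: r_def s_def)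
  hence eq: "p * s = r * q"
    using assms by (simp add: eq_fract)
  hence "pderiv (p * s) = pderiv (r * q)"
    by simp
  hence "pderiv p * s + p * pderiv s = pderiv r * q + r * pderiv q"
    by (simp add: pderiv_mult algebra_simps)
  with eq have "(pderiv r * s - r * pderiv s) * q\<^sup>2 = (pderiv p * q - p * pderiv q) * s\<^sup>2"
    by algebra
  with nz assms show ?thesis
    by (simp add: rf_deriv_def eq_fract flip: r_def s_def)
qed

(* The three counts are with multiplicity and are meaningful if the polynomial whose roots are
   counted is nonzero, so that the sum is finite. *)
definition num_zeros :: "ratfun \<Rightarrow> complex set \<Rightarrow> nat" where
  "num_zeros f G = (\<Sum>a | a \<in> G \<and> poly (rf_num f) a = 0. order a (rf_num f))"

definition num_poles :: "ratfun \<Rightarrow> complex set \<Rightarrow> nat" where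
  "num_poles f G = (\<Sum>a | a \<in> G \<and> poly (rf_den f) a = 0. order a (rf_den f))"

definition num_crit :: "ratfun \<Rightarrow> complex set \<Rightarrow> nat" where
  "num_crit f G = num_zeros (rf_deriv f) G"

(* The library sets infdist z {} = 0; the infimum over the empty set is meant to be infinite,
   so the neighborhood of the empty set is empty. *)
definition eps_nbhd :: "complex set \<Rightarrow> real \<Rightarrow> complex set" where
  "eps_nbhd K \<epsilon> = {z. K \<noteq> {} \<and> infdist z K < \<epsilon>}"

(* The zero function has infinitely many zeros and hence never satisfies the count condition;
   it is excluded explicitly because num_zeros 0 UNIV is a junk value. A nonzero constant has
   n = 0 and so no zeros, which leaves k = 0 and nothing to show about its vanishing
   derivative. *)
definition RAGL :: "nat \<Rightarrow> nat \<Rightarrow> real \<Rightarrow> complex set \<Rightarrow> bool" where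
  "RAGL n k \<epsilon> K \<longleftrightarrow>
     (\<forall>f. f \<noteq> 0 \<longrightarrow> num_zeros f UNIV + num_poles f UNIV = n \<longrightarrow>
          num_zeros f K \<ge> k \<longrightarrow> num_crit f (eps_nbhd K \<epsilon>) \<ge> k - 1)"

end

theory Submission
  imports Defs "HOL-Complex_Analysis.Conformal_Mappings"
begin

text \<open>
  Write \<open>f = g h / q\<close>, where \<open>g\<close> collects the \<open>m \<ge> k\<close> zeros of \<open>f\<close> in \<open>K\<close>, so that
  \<open>f' / f = g' / g + (h' / h - q' / q)\<close>. At distance \<open>\<delta>\<close> from \<open>K\<close>, all terms of
  \<open>g' / g = (\<Sum> 1 / (z - a))\<close> point into a common half-plane by convexity, whence
  \<open>|g' / g| \<ge> m \<delta> / (s + \<delta>)\<^sup>2\<close>. The second summand has at most \<open>d = n - k\<close> poles; by the pigeonhole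
  principle some \<open>\<delta>\<close> between \<open>\<epsilon> / 2\<close> and \<open>3 \<epsilon> / 4\<close> differs by at least \<open>\<epsilon> / (8 d)\<close> from
  all their distances to \<open>K\<close>, so that the summand is at most \<open>8 d\<^sup>2 / \<epsilon>\<close>, which the hypothesis on \<open>\<epsilon>\<close>
  makes smaller than the first one. By Rouche's theorem on the open \<open>\<delta>\<close>-neighborhood of \<open>K\<close>, the
  numerator \<open>(g h)' q - g h q'\<close> of \<open>f'\<close> has there as many zeros as \<open>g' h q\<close>, hence at least \<open>m - 1\<close>
  (Gauss--Lucas) plus the number of poles of \<open>f\<close>; passing to lowest terms cancels no more than the
  latter. Rouche's theorem is needed for a region whose boundary is not given as a path; it is
  obtained from the local constancy of the number of roots of \<open>A + t B\<close> in \<open>t\<close>.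
\<close>

subsection \<open>Continuity of the number of roots\<close>

text \<open>Counting through the multiset of roots makes additivity under products immediate. As
  \<open>proots 0\<close> is empty, the zero polynomial gets the count 0.\<close>

definition roots_in :: "complex set \<Rightarrow> complex poly \<Rightarrow> nat" where
  "roots_in G p = size (filter_mset (\<lambda>a. a \<in> G) (proots p))"

lemma roots_in_eq_sum:
  assumes "p \<noteq> 0"
  shows "roots_in G p = (\<Sum>a | a \<in> G \<and> poly p a = 0. order a p)"
proof -
  have "set_mset (filter_mset (\<lambda>a. a \<in> G) (proots p)) = {a. a \<in> G \<and> poly p a = 0}"
    using assms by auto
  then show ?thesis
    unfolding roots_in_def size_multiset_overloaded_eq using assms by (auto intro!: sum.cong)
qed

lemma roots_in_mult:
  assumes "p \<noteq> 0" "q \<noteq> 0"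
  shows "roots_in G (p * q) = roots_in G p + roots_in G q"
  using assms by (simp add: roots_in_def proots_mult)

lemma roots_in_linear: "w \<in> G \<Longrightarrow> roots_in G [:-w, 1:] = 1"
  using proots_linear_factor[of "-w"] by (simp add: roots_in_def)

lemma roots_in_eq_0_iff:
  assumes "p \<noteq> 0"
  shows "roots_in G p = 0 \<longleftrightarrow> (\<forall>a\<in>G. poly p a \<noteq> 0)"
  using assms by (auto simp: roots_in_def)

lemma roots_in_eq_degree:
  assumes "p \<noteq> 0" "\<And>a. poly p a = 0 \<Longrightarrow> a \<in> G"
  shows "roots_in G p = degree p"
proof -
  have "filter_mset (\<lambda>a. a \<in> G) (proots p) = proots p"
    using assms by (auto simp: filter_mset_eq_conv)
  then show ?thesis by (simp add: roots_in_def size_proots_complex)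
qed

lemma poly_eq_sum_degree_le:
  fixes p :: "'a :: comm_semiring_1 poly"
  assumes "degree p \<le> N"
  shows "poly p z = (\<Sum>i\<le>N. coeff p i * z ^ i)"
  using arg_cong[OF poly_as_sum_of_monoms'[OF assms], of "\<lambda>p. poly p z"]
  by (simp add: poly_sum poly_monom)

lemma eventually_poly_nonzero:
  assumes "((\<lambda>t. coeff (P t) (degree P0)) \<longlongrightarrow> coeff P0 (degree P0)) F"
    and "P0 \<noteq> 0"
  shows "\<forall>\<^sub>F t in F. P t \<noteq> (0 :: complex poly)"
proof -
  have "coeff P0 (degree P0) \<noteq> 0" using assms(2) by simp
  from tendsto_imp_eventually_ne[OF assms(1) this] show ?thesis
    by (rule eventually_mono) auto
qed

context
  fixes P :: "'b \<Rightarrow> complex poly" and P0 :: "complex poly" and N :: nat and F :: "'b filter"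
  assumes deg: "\<And>t. degree (P t) \<le> N" and deg0: "degree P0 \<le> N"
    and lim: "\<And>i. ((\<lambda>t. coeff (P t) i) \<longlongrightarrow> coeff P0 i) F"
begin

text \<open>The common degree bound \<open>N\<close> leaves finitely many coefficients, and on a set
  of radius \<open>R\<close> the difference of values is at most the sum of the coefficient
  differences weighted by powers of \<open>R\<close>.\<close>

lemma uniform_limit_poly_coeffs:
  assumes "bounded C"
  shows "uniform_limit C (\<lambda>t z. poly (P t) z) (poly P0) F"
proof -
  obtain R where R: "\<And>z. z \<in> C \<Longrightarrow> norm z \<le> R" using assms unfolding bounded_iff by auto
  have "((\<lambda>t. \<Sum>i\<le>N. norm (coeff (P t) i - coeff P0 i) * R ^ i) \<longlongrightarrow>
      (\<Sum>i\<le>N. norm (coeff P0 i - coeff P0 i) * R ^ i)) F"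
    by (intro tendsto_intros lim)
  then have 0: "((\<lambda>t. \<Sum>i\<le>N. norm (coeff (P t) i - coeff P0 i) * R ^ i) \<longlongrightarrow> 0) F" by simp
  have le: "dist (poly (P t) z) (poly P0 z) \<le> (\<Sum>i\<le>N. norm (coeff (P t) i - coeff P0 i) * R ^ i)"
    if "z \<in> C" for t z
  proof -
    have "poly (P t) z - poly P0 z = (\<Sum>i\<le>N. (coeff (P t) i - coeff P0 i) * z ^ i)"
      by (simp add: poly_eq_sum_degree_le[OF deg] poly_eq_sum_degree_le[OF deg0]
          sum_subtractf algebra_simps)
    also have "norm \<dots> \<le> (\<Sum>i\<le>N. norm (coeff (P t) i - coeff P0 i) * R ^ i)"
      using R[OF that] by (intro sum_norm_le)
        (auto simp: norm_mult norm_power intro!: mult_left_mono power_mono)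
    finally show ?thesis by (simp add: dist_norm)
  qed
  show ?thesis
  proof (rule uniform_limitI)
    fix e :: real assume "e > 0"
    with 0 have "\<forall>\<^sub>F t in F. (\<Sum>i\<le>N. norm (coeff (P t) i - coeff P0 i) * R ^ i) < e"
      by (rule order_tendstoD)
    then show "\<forall>\<^sub>F t in F. \<forall>z\<in>C. dist (poly (P t) z) (poly P0 z) < e"
      by eventually_elim (use le in \<open>fastforce intro: le_less_trans\<close>)
  qed
qed

text \<open>Horner's scheme computes each coefficient of the quotient from the next higher one, so
  convergence descends from index \<open>N\<close>, where all coefficients vanish.\<close>

lemma tendsto_coeff_synthetic_div:
  assumes "(w \<longlongrightarrow> w0) F"
  shows "((\<lambda>t. coeff (synthetic_div (P t) (w t)) i) \<longlongrightarrow> coeff (synthetic_div P0 w0) i) F"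
proof -
  have synth: "coeff (synthetic_div p c) i = coeff p (Suc i) + c * coeff (synthetic_div p c) (Suc i)"
    for p :: "complex poly" and c i
    using arg_cong[OF synthetic_div_correct[of p c], of "\<lambda>r. coeff r (Suc i)"] by simp
  \<comment> \<open>The quotient has degree one less than \<open>p\<close>, hence no coefficient at
    \<open>N\<close> or above. Constants need a separate case: their quotient is 0, but its degree
    is not smaller than 0.\<close>
  have zero: "coeff (synthetic_div p c) i = 0" if "degree p \<le> N" "N \<le> i"
    for p :: "complex poly" and c i
  proof (cases "degree p = 0")
    case True
    then show ?thesis using synthetic_div_eq_0_iff[of p c] by simp
  next
    case False
    then show ?thesis using that by (intro coeff_eq_0) (simp add: degree_synthetic_div)
  qed
  show ?thesis
  proof (cases "i \<le> N")
    case True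
    then show ?thesis
    proof (induction i rule: inc_induct)
      case base
      then show ?case by (simp add: zero deg deg0)
    next
      case (step i)
      show ?case
        unfolding synth[of _ _ i] by (intro tendsto_intros lim assms step.IH)
    qed
  next
    case False
    then show ?thesis by (simp add: zero deg deg0)
  qed
qed

text \<open>On a small circle around \<open>w0\<close> the modulus of \<open>P0\<close> has a
  minimum \<open>m > 0\<close>. Once \<open>P t\<close> is within \<open>m / 2\<close> of
  \<open>P0\<close>, it is smaller at the centre than on the circle, so by the minimum modulus
  principle it vanishes inside.\<close>

lemma eventually_root_near:
  assumes "P0 \<noteq> 0" "poly P0 w0 = 0" "e > 0"
  shows "\<forall>\<^sub>F t in F. \<exists>w. poly (P t) w = 0 \<and> dist w w0 < e"
proof -
  have "\<forall>\<^sub>F z in at w0. poly P0 z \<noteq> 0"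
  proof -
    have "finite {z. poly P0 z = 0}" using assms(1) by (rule poly_roots_finite)
    then have "finite ({z. poly P0 z = 0} - {w0})" by blast
    then have "closed ({z. poly P0 z = 0} - {w0})" by (rule finite_imp_closed)
    then have "open (- ({z. poly P0 z = 0} - {w0}))" by blast
    then show ?thesis unfolding eventually_at_topological by blast
  qed
  then obtain d where d: "d > 0" "\<And>z. z \<noteq> w0 \<Longrightarrow> dist z w0 < d \<Longrightarrow> poly P0 z \<noteq> 0"
    unfolding eventually_at by auto
  define r where "r = min d e / 2"
  have r: "r > 0" "r < d" "r < e" using d assms by (auto simp: r_def)
  have "continuous_on (sphere w0 r) (\<lambda>z. norm (poly P0 z))" by (intro continuous_intros)
  moreover have "sphere w0 r \<noteq> {}" using r by simp
  ultimately obtain z0 where z0: "z0 \<in> sphere w0 r"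
    "\<And>z. z \<in> sphere w0 r \<Longrightarrow> norm (poly P0 z0) \<le> norm (poly P0 z)"
    using continuous_attains_inf[of "sphere w0 r" "\<lambda>z. norm (poly P0 z)"] by auto
  define m where "m = norm (poly P0 z0)"
  have "z0 \<noteq> w0" "dist z0 w0 < d" using z0(1) r by (auto simp: dist_commute)
  then have m: "m > 0" using d(2) by (simp add: m_def)
  have "\<forall>\<^sub>F t in F. \<forall>z\<in>cball w0 r. dist (poly (P t) z) (poly P0 z) < m / 2"
    using uniform_limitD[OF uniform_limit_poly_coeffs[of "cball w0 r"], of "m / 2"] m by simp
  then show ?thesis
  proof eventually_elim
    case (elim t)
    have "norm (poly (P t) w0) < m / 2"
      using elim[rule_format, of w0] assms r by simp
    moreover have "norm (poly (P t) z) > m / 2" if "norm (w0 - z) = r" for z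
    proof -
      have "norm (poly P0 z) \<ge> m" using z0(2)[of z] that by (simp add: m_def dist_norm)
      moreover have "dist (poly (P t) z) (poly P0 z) < m / 2"
        using elim that by (simp add: dist_norm)
      moreover have "norm (poly P0 z) \<le> norm (poly (P t) z) + dist (poly (P t) z) (poly P0 z)"
        by (metis dist_norm dist_commute norm_triangle_sub)
      ultimately show ?thesis by simp
    qed
    ultimately have "norm (poly (P t) w0) < norm (poly (P t) z)" if "norm (w0 - z) = r" for z
      using that less_trans by blast
    moreover have "continuous_on (cball w0 r) (\<lambda>z. poly (P t) z)" by (intro continuous_intros)
    moreover have "(\<lambda>z. poly (P t) z) holomorphic_on ball w0 r" by (intro holomorphic_intros)
    ultimately obtain w where "w \<in> ball w0 r" "poly (P t) w = 0"
      using r(1) by (metis holomorphic_contract_to_zero)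
    then show ?case using r by (intro exI[of _ w]) (auto simp: dist_commute)
  qed
qed

text \<open>Taking a root closest to \<open>w0\<close> gives one function \<open>w\<close> that
  serves every \<open>e\<close> at once. The minimum exists as soon as \<open>P t\<close> is nonzero
  and so has finitely many roots.\<close>

lemma eventually_root_selection:
  assumes "P0 \<noteq> 0" "poly P0 w0 = 0"
  obtains w where "(w \<longlongrightarrow> w0) F" "\<forall>\<^sub>F t in F. poly (P t) (w t) = 0"
proof -
  define w where "w t = arg_min_on (\<lambda>z. dist z w0) {z. poly (P t) z = 0}" for t
  have nz: "\<forall>\<^sub>F t in F. P t \<noteq> 0"
    using eventually_poly_nonzero[OF lim] assms(1) .
  have near: "\<forall>\<^sub>F t in F. poly (P t) (w t) = 0 \<and> dist (w t) w0 < e" if "e > 0" for e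
    using nz eventually_root_near[OF assms that]
  proof eventually_elim
    case (elim t)
    then have fin: "finite {z. poly (P t) z = 0}" by (simp add: poly_roots_finite)
    from elim obtain v where v: "poly (P t) v = 0" "dist v w0 < e" by auto
    have "w t \<in> {z. poly (P t) z = 0}" "dist (w t) w0 \<le> dist v w0"
      unfolding w_def using arg_min_if_finite(1)[OF fin]
        arg_min_least[OF fin, of v "\<lambda>z. dist z w0"] v by auto
    then show ?case using v by auto
  qed
  show ?thesis
  proof (rule that)
    show "(w \<longlongrightarrow> w0) F"
      by (rule tendstoI) (use near in \<open>blast intro: eventually_mono\<close>)
    show "\<forall>\<^sub>F t in F. poly (P t) (w t) = 0"
      using near[of 1] by (auto elim: eventually_mono)
  qed
qed

end

text \<open>The induction is on the number of roots of the limit: a root \<open>w0\<close> of the limit attracts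
  roots \<open>w t\<close>, and dividing by \<open>z - w0\<close> resp. \<open>z - w t\<close> preserves the convergence. Degrees may
  drop in the limit.\<close>

lemma eventually_roots_in_eq:
  fixes P :: "'b \<Rightarrow> complex poly"
  assumes "open U" "bounded U"
    and "\<And>t. degree (P t) \<le> N" "degree P0 \<le> N"
    and "\<And>i. ((\<lambda>t. coeff (P t) i) \<longlongrightarrow> coeff P0 i) F"
    and "P0 \<noteq> 0" "\<And>z. z \<in> frontier U \<Longrightarrow> poly P0 z \<noteq> 0"
  shows "\<forall>\<^sub>F t in F. roots_in U (P t) = roots_in U P0"
  using assms(3-)
proof (induction "roots_in U P0" arbitrary: P P0)
  case 0
  note lim = uniform_limit_poly_coeffs[OF "0.prems"(1-3)]
  have nz: "\<forall>\<^sub>F t in F. P t \<noteq> 0"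
    using eventually_poly_nonzero "0.prems"(3,4) .
  have ne: "poly P0 z \<noteq> 0" if "z \<in> closure U" for z
    using that 0 roots_in_eq_0_iff[of P0 U] closure_Un_frontier[of U] by auto
  \<comment> \<open>\<open>P0\<close> has no zero on the compact closure, so its modulus is bounded
    below there, and any uniformly close \<open>P t\<close> is zero-free on
    \<open>U\<close>.\<close>
  have "\<exists>m>0. \<forall>z\<in>closure U. m \<le> norm (poly P0 z)"
  proof (cases "U = {}")
    case False
    then have "compact (closure U)" "closure U \<noteq> {}" using assms(2) by auto
    moreover have "continuous_on (closure U) (\<lambda>z. norm (poly P0 z))" by (intro continuous_intros)
    ultimately show ?thesis using continuous_attains_inf[of "closure U"] ne
      by (metis zero_less_norm_iff)
  qed (auto intro: exI[of _ 1])
  then obtain m where m: "m > 0" "\<And>z. z \<in> closure U \<Longrightarrow> m \<le> norm (poly P0 z)" by auto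
  have "\<forall>\<^sub>F t in F. \<forall>z\<in>closure U. dist (poly (P t) z) (poly P0 z) < m"
    using lim[of "closure U"] m assms(2) unfolding uniform_limit_iff by (simp add: bounded_closure)
  with nz show ?case
  proof eventually_elim
    case (elim t)
    have "poly (P t) z \<noteq> 0" if "z \<in> U" for z
    proof
      assume "poly (P t) z = 0"
      moreover have "z \<in> closure U" using that closure_subset by blast
      ultimately show False using elim(2) m(2)[of z] by (force simp: dist_norm)
    qed
    then show ?case using roots_in_eq_0_iff[of "P t" U] elim(1) 0(1) by auto
  qed
next
  case (Suc c)
  note prems = Suc.prems(1-3)
  from Suc obtain w0 where w0: "w0 \<in> U" "poly P0 w0 = 0"
    using roots_in_eq_0_iff[of P0 U] by fastforce
  obtain w where w: "(w \<longlongrightarrow> w0) F" "\<forall>\<^sub>F t in F. poly (P t) (w t) = 0"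
    using eventually_root_selection[OF prems Suc.prems(4) w0(2)] by blast
  define Q where "Q t = synthetic_div (P t) (w t)" for t
  define Q0 where "Q0 = synthetic_div P0 w0"
  have P0_eq: "P0 = [:-w0, 1:] * Q0"
    using synthetic_div_correct'[of w0 P0] w0 by (simp add: Q0_def)
  have Q0: "Q0 \<noteq> 0" using P0_eq Suc.prems by auto
  \<comment> \<open>Openness of \<open>U\<close> keeps the moving root inside, so both sides lose
    exactly one root by the division.\<close>
  have "\<forall>\<^sub>F t in F. w t \<in> U" using w(1) w0 assms(1) by (rule_tac topological_tendstoD)
  moreover have "\<forall>\<^sub>F t in F. roots_in U (Q t) = roots_in U Q0"
  proof (rule Suc.hyps(1))
    show "c = roots_in U Q0"
      using Suc.hyps(2) w0 Q0 roots_in_linear[of w0 U]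
      by (simp add: P0_eq roots_in_mult del: mult_pCons_left)
    show "degree (Q t) \<le> N" for t
      using prems(1)[of t] by (simp add: Q_def degree_synthetic_div)
    show "degree Q0 \<le> N" using prems by (simp add: Q0_def degree_synthetic_div)
    show "((\<lambda>t. coeff (Q t) i) \<longlongrightarrow> coeff Q0 i) F" for i
      unfolding Q_def Q0_def by (rule tendsto_coeff_synthetic_div[OF prems w(1)])
    show "Q0 \<noteq> 0" by fact
    show "poly Q0 z \<noteq> 0" if "z \<in> frontier U" for z
      using Suc.prems(5)[OF that] P0_eq by auto
  qed
  moreover have "\<forall>\<^sub>F t in F. Q t \<noteq> 0"
    using eventually_poly_nonzero
      tendsto_coeff_synthetic_div[OF prems w(1), folded Q_def Q0_def] Q0 .
  ultimately show ?case using w(2)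
  proof eventually_elim
    case (elim t)
    have "P t = [:-w t, 1:] * Q t"
      using synthetic_div_correct'[of "w t" "P t"] elim by (simp add: Q_def)
    then have "roots_in U (P t) = Suc (roots_in U (Q t))"
      using elim roots_in_linear[of "w t" U] by (simp add: roots_in_mult del: mult_pCons_left)
    also have "\<dots> = roots_in U P0"
      using elim w0 Q0 roots_in_linear[of w0 U]
      by (simp add: P0_eq roots_in_mult del: mult_pCons_left)
    finally show ?case .
  qed
qed

section \<open>Rouche's theorem for polynomials on a bounded open set\<close>

text \<open>The strict inequality keeps \<open>A + t B\<close> zero-free on the frontier for all
  \<open>t\<close> in the unit interval. The number of roots is then locally constant in
  \<open>t\<close>, hence constant by connectedness.\<close>

lemma Rouche_poly:
  assumes "open U" "bounded U" "U \<noteq> {}"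
    and less: "\<And>z. z \<in> frontier U \<Longrightarrow> norm (poly B z) < norm (poly A z)"
  shows "roots_in U (A + B) = roots_in U A"
proof -
  define P where "P t = A + smult (of_real t) B" for t :: real
  have ne: "poly (P t) z \<noteq> 0" if "t \<in> {0..1}" "z \<in> frontier U" for t z
  proof
    assume "poly (P t) z = 0"
    then have "norm (poly A z) = t * norm (poly B z)"
      using that by (simp add: P_def add_eq_0_iff2 norm_mult)
    also have "\<dots> \<le> 1 * norm (poly B z)" using that by (intro mult_right_mono) auto
    finally show False using less[OF that(2)] by simp
  qed
  \<comment> \<open>A point of the frontier is needed as a witness that \<open>P t\<close> is not
    the zero polynomial.\<close>
  have "U \<noteq> UNIV" using assms(2) not_bounded_UNIV by blast
  then have "frontier U \<noteq> {}" using assms(3) frontier_eq_empty by blast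
  then have nz: "P t \<noteq> 0" if "t \<in> {0..1}" for t using ne[OF that] by force
  define N where "N = max (degree A) (degree B)"
  have deg: "degree (P t) \<le> N" for t
    unfolding P_def N_def by (intro degree_add_le) (auto intro: order_trans[OF degree_smult_le])
  have "roots_in U (P 0) = roots_in U (P 1)"
  proof (rule connected_local_const[of "{0..1::real}"])
    show "\<forall>a\<in>{0..1}. \<forall>\<^sub>F b in at a within {0..1}. roots_in U (P a) = roots_in U (P b)"
    proof
      fix a :: real assume a: "a \<in> {0..1}"
      have "((\<lambda>t. coeff (P t) i) \<longlongrightarrow> coeff (P a) i) (at a within {0..1})" for i
        unfolding P_def coeff_add coeff_smult by (intro tendsto_intros)
      from eventually_roots_in_eq[OF assms(1,2) deg deg this nz[OF a] ne[OF a]]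
      show "\<forall>\<^sub>F b in at a within {0..1}. roots_in U (P a) = roots_in U (P b)"
        by (simp add: eq_commute)
    qed
  qed auto
  then show ?thesis by (simp add: P_def)
qed

subsection \<open>Logarithmic derivatives\<close>

lemma pderiv_prod_linear_div:
  assumes "poly (\<Prod>a\<in>#M. [:-a, 1:]) z \<noteq> (0 :: 'a :: field)"
  shows "poly (pderiv (\<Prod>a\<in>#M. [:-a, 1:])) z / poly (\<Prod>a\<in>#M. [:-a, 1:]) z
    = (\<Sum>a\<in>#M. 1 / (z - a))"
  using assms
proof (induction M)
  case (add a M)
  then show ?case
    by (simp add: pderiv_mult pderiv_pCons field_simps del: mult_pCons_left)
qed simp

lemma pderiv_div_eq_sum_proots:
  fixes p :: "complex poly"
  assumes "poly p z \<noteq> 0"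
  shows "poly (pderiv p) z / poly p z = (\<Sum>a\<in>#proots p. 1 / (z - a))"
proof -
  define r where "r = (\<Prod>a\<in>#proots p. [:-a, 1:])"
  have p: "smult (lead_coeff p) r = p" unfolding r_def by (rule complex_poly_decompose_multiset)
  have "poly (pderiv (smult (lead_coeff p) r)) z / poly (smult (lead_coeff p) r) z
    = poly (pderiv r) z / poly r z"
    using assms by (auto simp: pderiv_smult)
  moreover have "poly r z \<noteq> 0" using assms by (subst (asm) p[symmetric]) auto
  ultimately show ?thesis unfolding p using pderiv_prod_linear_div[of "proots p" z]
    by (simp add: r_def)
qed

lemma proots_prod_linear: "proots (\<Prod>a\<in>#M. [:-a, 1:]) = (M :: 'a :: idom multiset)"
proof (induction M)
  case (add a M)
  have "(\<Prod>a\<in>#M. [:-a, 1:]) \<noteq> 0" by (auto simp: prod_mset_zero_iff)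
  then show ?case
    using add proots_linear_factor[of "-a"] by (simp add: proots_mult del: mult_pCons_left)
qed simp

lemma norm_sum_inverse_le:
  fixes z :: complex
  assumes "c > 0" "\<And>a. a \<in># M \<Longrightarrow> c \<le> norm (z - a)"
  shows "norm (\<Sum>a\<in>#M. 1 / (z - a)) \<le> size M / c"
  using assms(2)
proof (induction M)
  case (add a M)
  have "norm (1 / (z - a)) \<le> 1 / c"
    using add.prems[of a] assms(1) by (simp add: norm_divide frac_le)
  moreover have "norm (\<Sum>a\<in>#M. 1 / (z - a)) \<le> size M / c"
    using add by auto
  ultimately show ?case
    using norm_triangle_ineq[of "1 / (z - a)" "\<Sum>a\<in>#M. 1 / (z - a)"]
    by (simp add: add_divide_distrib)
qed simp

text \<open>Let \<open>u\<close> be the unit vector from the projection \<open>y\<close> of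
  \<open>z\<close> to \<open>z\<close>. Convexity puts \<open>K\<close> behind the line through
  \<open>y\<close> orthogonal to \<open>u\<close>, so each \<open>z - a\<close> has component at
  least \<delta> along \<open>u\<close>. Its length is at most \<open>diameter K + \<delta>\<close>,
  which bounds the real part of \<open>u / (z - a)\<close> from below, and these real parts add
  up.\<close>

lemma norm_sum_inverse_ge:
  fixes z :: complex
  assumes K: "bounded K" "convex K" "K \<noteq> {}" and M: "set_mset M \<subseteq> K"
    and \<delta>: "infdist z K = \<delta>" "\<delta> > 0"
  shows "size M * (\<delta> / (diameter K + \<delta>)\<^sup>2) \<le> norm (\<Sum>a\<in>#M. 1 / (z - a))"
proof -
  \<comment> \<open>\<open>K\<close> need not be closed; passing to the closure changes neither
    distances to \<open>K\<close> nor the diameter.\<close>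
  define y where "y = closest_point (closure K) z"
  define u where "u = (z - y) /\<^sub>R \<delta>"
  have y: "y \<in> closure K" unfolding y_def using K by (intro closest_point_in_set) auto
  have dist_y: "norm (z - y) = \<delta>"
  proof (rule antisym)
    have "norm (z - y) \<le> dist z a" if "a \<in> K" for a
      unfolding y_def dist_norm[symmetric] using that closure_subset
      by (intro closest_point_le) auto
    then show "norm (z - y) \<le> \<delta>" using \<delta>(1) K(3) by (auto simp: infdist_def intro!: cINF_greatest)
    have "infdist z K \<le> infdist y K + dist z y" by (rule infdist_triangle)
    then show "\<delta> \<le> norm (z - y)"
      using y K(3) \<delta>(1) in_closure_iff_infdist_zero[of K y] by (simp add: dist_norm)
  qed
  have u: "norm u = 1" using dist_y \<delta>(2) by (simp add: u_def)
  have le_Re: "\<delta> / (diameter K + \<delta>)\<^sup>2 \<le> Re (u / (z - a))" if "a \<in> K" for a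
  proof -
    have a: "a \<in> closure K" using that closure_subset by blast
    have "inner (z - y) (a - y) \<le> 0"
      unfolding y_def using K(2) a by (intro closest_point_dot) (auto simp: convex_closure)
    then have "inner (z - y) (z - a) \<ge> inner (z - y) (z - y)"
      by (simp add: inner_diff_right algebra_simps)
    then have "inner (z - y) (z - a) \<ge> \<delta>\<^sup>2" using dist_y by (simp add: dot_square_norm)
    then have inner: "inner u (z - a) \<ge> \<delta>"
      using \<delta>(2) unfolding u_def inner_scaleR_left by (simp add: field_simps power2_eq_square)
    then have nz: "z \<noteq> a" using \<delta>(2) by auto
    have "norm (y - a) \<le> diameter K"
      using diameter_bounded_bound[of "closure K" y a] y a K(1)
      by (simp add: diameter_closure bounded_closure dist_norm)
    then have le: "norm (z - a) \<le> diameter K + \<delta>"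
      using dist_y norm_triangle_ineq[of "z - y" "y - a"] by simp
    have "\<delta> / (diameter K + \<delta>)\<^sup>2 \<le> inner u (z - a) / (norm (z - a))\<^sup>2"
      using inner le nz \<delta>(2) by (intro frac_le power_mono) auto
    also have "\<dots> = Re (u / (z - a))"
      by (simp add: Re_divide inner_complex_def cmod_power2)
    finally show ?thesis .
  qed
  have "size M * (\<delta> / (diameter K + \<delta>)\<^sup>2) \<le> Re (\<Sum>a\<in>#M. u / (z - a))"
    using M
  proof (induction M)
    case (add a M)
    then show ?case using le_Re[of a] by (simp add: algebra_simps add_divide_distrib)
  qed simp
  also have "\<dots> \<le> norm (\<Sum>a\<in>#M. u / (z - a))" by (rule complex_Re_le_cmod)
  also have "(\<Sum>a\<in>#M. u / (z - a)) = u * (\<Sum>a\<in>#M. 1 / (z - a))"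
    by (simp add: sum_mset_distrib_left)
  finally show ?thesis using u by (simp add: norm_mult)
qed

subsection \<open>Critical points of rational functions\<close>

text \<open>At a zero of \<open>q\<close> the factor \<open>p\<close> does not vanish, and
  differentiation lowers the order of \<open>q\<close> by one. A higher order of the Wronskian would
  force the full power \<open>l\<close> to divide \<open>p * pderiv q\<close>, hence
  \<open>pderiv q\<close>.\<close>

lemma order_wronskian_le:
  fixes p q :: "complex poly"
  assumes "coprime p q" "q \<noteq> 0" "poly q a = 0" "pderiv p * q - p * pderiv q \<noteq> 0"
  shows "order a (pderiv p * q - p * pderiv q) \<le> order a q"
proof (rule ccontr)
  define W where "W = pderiv p * q - p * pderiv q"
  define l where "l = [:-a, 1:] ^ order a q"
  assume "\<not> ?thesis"
  then have "l dvd W" using assms(4) unfolding l_def W_def order_divides by simp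
  moreover have "l dvd pderiv p * q" unfolding l_def by (simp add: order_1 dvd_mult)
  ultimately have "l dvd pderiv p * q - W" by (simp add: dvd_diff)
  then have "l dvd p * pderiv q" by (simp add: W_def)
  moreover have "coprime l p"
    unfolding l_def using assms order_1[of a q] by (metis coprime_commute coprime_divisors dvd_refl)
  ultimately have "l dvd pderiv q" by (simp add: coprime_dvd_mult_right_iff)
  moreover have "order a q = Suc (order a (pderiv q))" using assms by (intro order_pderiv)
  moreover have "pderiv q \<noteq> 0"
    using assms by (metis degree_eq_zeroE order_degree order_root le_zero_eq pderiv_eq_0_iff)
  ultimately show False unfolding l_def order_divides by simp
qed

text \<open>In lowest terms \<open>r / t\<close> of \<open>rf_deriv f\<close>, orders are compared
  in \<open>W f * t = r * q\<^sup>2\<close>. Away from the zeros of \<open>q\<close> nothing of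
  \<open>W f\<close> is lost; at them \<open>W f\<close> has order at most that of
  \<open>q\<close>.\<close>

lemma roots_in_wronskian_le:
  defines "W f \<equiv> pderiv (rf_num f) * rf_den f - rf_num f * pderiv (rf_den f)"
  shows "roots_in G (W f) \<le> roots_in G (rf_num (rf_deriv f)) + roots_in G (rf_den f)"
proof (cases "W f = 0")
  case True
  then show ?thesis by (simp add: roots_in_def)
next
  case False
  define q r t where "q = rf_den f" and "r = rf_num (rf_deriv f)" and "t = rf_den (rf_deriv f)"
  have q: "q \<noteq> 0" "coprime (rf_num f) q" using rf_lowest_terms[of f] by (simp_all add: q_def)
  have rt: "coprime r t" "t \<noteq> 0" "rf_deriv f = Fract r t"
    using rf_lowest_terms[of "rf_deriv f"] by (simp_all add: r_def t_def)
  have "rf_deriv f = Fract (W f) (q\<^sup>2)" by (simp add: rf_deriv_def W_def q_def)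
  with rt q have eq: "W f * t = r * q\<^sup>2" by (simp add: eq_fract)
  with False rt have r: "r \<noteq> 0" by auto
  have le: "order a (W f) \<le> order a r + order a q" for a
  proof (cases "poly q a = 0")
    case True
    have "order a (W f) \<le> order a q"
      using False order_wronskian_le[OF q(2,1) True] by (simp add: W_def q_def)
    then show ?thesis by simp
  next
    case qa: False
    have "order a (W f) + order a t = order a r + order a (q\<^sup>2)"
      using arg_cong[OF eq, of "order a"] False rt r q by (simp add: order_mult)
    moreover have "order a (q\<^sup>2) = 0" using qa by (intro order_0I) simp
    ultimately show ?thesis by simp
  qed
  have "filter_mset (\<lambda>a. a \<in> G) (proots (W f)) \<subseteq>#
      filter_mset (\<lambda>a. a \<in> G) (proots r + proots q)"
    using le False r q by (intro multiset_filter_mono mset_subset_eqI) simp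
  from size_mset_mono[OF this] show ?thesis by (simp add: roots_in_def q_def r_def)
qed

text \<open>Here \<delta> is the radius of the neighborhood and \<open>c\<close> bounds from below
  the distance of its frontier to the zeros outside \<open>K\<close> and to the poles. The
  assumption \<open>less\<close> is the comparison of logarithmic derivatives that Rouche's theorem
  requires.\<close>

lemma roots_in_wronskian_ge:
  fixes p q :: "complex poly" and K :: "complex set"
  defines "m \<equiv> roots_in K p"
  assumes K: "bounded K" "convex K" and pq: "p \<noteq> 0" "q \<noteq> 0" and "m > 0"
    and "\<delta> > 0" "c > 0"
    and sep: "\<And>b. poly p b = 0 \<and> b \<notin> K \<or> poly q b = 0 \<Longrightarrow> c \<le> \<bar>infdist b K - \<delta>\<bar>"
    and less: "(degree p + degree q - m) / c < m * (\<delta> / (diameter K + \<delta>)\<^sup>2)"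
  defines "U \<equiv> {z. infdist z K < \<delta>}"
  shows "m - 1 + roots_in U q \<le> roots_in U (pderiv p * q - p * pderiv q)"
proof -
  define g where "g = (\<Prod>a\<in>#filter_mset (\<lambda>a. a \<in> K) (proots p). [:-a, 1:])"
  define h where "h = smult (lead_coeff p) (\<Prod>a\<in>#filter_mset (\<lambda>a. a \<notin> K) (proots p). [:-a, 1:])"
  have proots_p: "proots p = filter_mset (\<lambda>a. a \<in> K) (proots p) + filter_mset (\<lambda>a. a \<notin> K) (proots p)"
    by (rule multiset_partition)
  have p: "p = g * h"
  proof -
    have "p = smult (lead_coeff p) (\<Prod>a\<in>#proots p. [:-a, 1:])"
      by (rule complex_poly_decompose_multiset[symmetric])
    also have "\<dots> = g * h"
      by (subst proots_p) (simp only: g_def h_def image_mset_union prod_mset.union mult_smult_right)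
    finally show ?thesis .
  qed
  with pq have gh: "g \<noteq> 0" "h \<noteq> 0" by auto
  have proots_g: "proots g = filter_mset (\<lambda>a. a \<in> K) (proots p)"
    unfolding g_def by (rule proots_prod_linear)
  have proots_h: "proots h = filter_mset (\<lambda>a. a \<notin> K) (proots p)"
    unfolding h_def using pq by (simp add: proots_prod_linear)
  have size_g: "size (proots g) = m" by (simp add: m_def roots_in_def proots_g)
  then have deg_g: "degree g = m" by (simp add: size_proots_complex)
  have g_in: "set_mset (proots g) \<subseteq> K" by (auto simp: proots_g)
  have "K \<noteq> {}" using \<open>m > 0\<close> by (auto simp: m_def roots_in_def)
  note K = K this
  have cont: "continuous_on UNIV (\<lambda>z. infdist z K)" by (intro continuous_intros)
  have U: "open U" unfolding U_def using cont by (intro open_Collect_less) (auto intro: continuous_intros)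
  have "K \<subseteq> U" using \<open>\<delta> > 0\<close> by (auto simp: U_def)
  with K have "U \<noteq> {}" by blast
  have "bounded U"
  proof -
    obtain x R where R: "\<And>a. a \<in> K \<Longrightarrow> dist x a \<le> R" using K unfolding bounded_def by auto
    have "dist x z \<le> R + \<delta>" if "z \<in> U" for z
    proof -
      have "\<not> (\<forall>a\<in>K. \<delta> \<le> dist z a)"
      proof
        assume "\<forall>a\<in>K. \<delta> \<le> dist z a"
        then have "\<delta> \<le> infdist z K" using K by (auto simp: infdist_notempty intro: cINF_greatest)
        then show False using that by (simp add: U_def)
      qed
      then obtain a where "a \<in> K" "dist z a < \<delta>" by (auto simp: not_le)
      then show ?thesis using R[of a] dist_triangle[of x z a] by (simp add: dist_commute)
    qed
    then show ?thesis unfolding bounded_def by blast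
  qed
  have frontier: "infdist z K = \<delta>" if "z \<in> frontier U" for z
  proof (rule antisym)
    have "closed {z. infdist z K \<le> \<delta>}"
      using cont by (intro closed_Collect_le) (auto intro: continuous_intros)
    then have "closure U \<subseteq> {z. infdist z K \<le> \<delta>}"
      unfolding U_def by (intro closure_minimal) auto
    then show "infdist z K \<le> \<delta>" using that by (auto simp: frontier_def)
    show "\<delta> \<le> infdist z K" using that U by (auto simp: frontier_def interior_open U_def)
  qed
  \<comment> \<open>This is stated for every positive distance because it is used twice: on the
    frontier of \<open>U\<close> for Rouche's theorem, and off the closure of \<open>K\<close> to
    locate the zeros of \<open>pderiv g\<close>.\<close>
  have lower: "m * (infdist z K / (diameter K + infdist z K)\<^sup>2) \<le> norm (poly (pderiv g) z / poly g z)"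
    and g_nz: "poly g z \<noteq> 0" if "infdist z K > 0" for z
  proof -
    show "poly g z \<noteq> 0"
    proof
      assume "poly g z = 0"
      then have "z \<in> K" using g_in gh by auto
      then show False using that by simp
    qed
    then show "m * (infdist z K / (diameter K + infdist z K)\<^sup>2) \<le> norm (poly (pderiv g) z / poly g z)"
      using norm_sum_inverse_ge[OF K g_in refl that] by (simp add: pderiv_div_eq_sum_proots size_g)
  qed
  \<comment> \<open>Divided by \<open>g * h * q\<close>, these become \<open>g' / g\<close> and
    \<open>h' / h - q' / q\<close>.\<close>
  define A where "A = pderiv g * h * q"
  define B where "B = g * (pderiv h * q - h * pderiv q)"
  have "norm (poly B z) < norm (poly A z)" if "z \<in> frontier U" for z
  proof -
    have z: "infdist z K = \<delta>" using frontier that .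
    \<comment> \<open>The distance to \<open>K\<close> is 1-Lipschitz, so a gap between distances to
      \<open>K\<close> is a gap between the points.\<close>
    have far: "c \<le> norm (z - b)" if "b \<in># proots h + proots q" for b
    proof -
      have "poly p b = 0 \<and> b \<notin> K \<or> poly q b = 0" using that pq by (auto simp: proots_h)
      from sep[OF this] show ?thesis
        using infdist_triangle_abs[of z K b] z by (simp add: dist_norm abs_minus_commute)
    qed
    have nz: "poly g z \<noteq> 0" "poly h z \<noteq> 0" "poly q z \<noteq> 0"
      using g_nz[of z] z \<open>\<delta> > 0\<close> far[of z] gh pq \<open>c > 0\<close> by auto
    have "norm (poly (pderiv h) z / poly h z - poly (pderiv q) z / poly q z)
        \<le> norm (poly (pderiv h) z / poly h z) + norm (poly (pderiv q) z / poly q z)"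
      by (rule norm_triangle_ineq4)
    also have "\<dots> \<le> size (proots h) / c + size (proots q) / c"
      unfolding pderiv_div_eq_sum_proots[OF nz(2)] pderiv_div_eq_sum_proots[OF nz(3)]
      using far \<open>c > 0\<close> by (intro add_mono norm_sum_inverse_le) auto
    also have "\<dots> = (degree p + degree q - m) / c"
      using gh deg_g by (simp add: size_proots_complex p degree_mult_eq add_divide_distrib)
    also have "\<dots> < norm (poly (pderiv g) z / poly g z)"
      using less lower[of z] z \<open>\<delta> > 0\<close> by simp
    finally have "norm (poly g z * poly h z * poly q z)
        * norm (poly (pderiv h) z / poly h z - poly (pderiv q) z / poly q z)
      < norm (poly g z * poly h z * poly q z) * norm (poly (pderiv g) z / poly g z)"
      using nz by (intro mult_strict_left_mono) auto
    moreover have "poly B z = poly g z * poly h z * poly q z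
        * (poly (pderiv h) z / poly h z - poly (pderiv q) z / poly q z)"
      using nz by (simp add: B_def field_simps)
    moreover have "poly A z = poly g z * poly h z * poly q z * (poly (pderiv g) z / poly g z)"
      using nz by (simp add: A_def)
    ultimately show ?thesis by (simp only: norm_mult)
  qed
  then have "roots_in U (A + B) = roots_in U A"
    by (rule Rouche_poly[OF U \<open>bounded U\<close> \<open>U \<noteq> {}\<close>])
  moreover have "A + B = pderiv p * q - p * pderiv q"
    by (simp add: A_def B_def p pderiv_mult algebra_simps)
  moreover have "m - 1 + roots_in U q \<le> roots_in U A"
  proof -
    have g': "pderiv g \<noteq> 0" using deg_g \<open>m > 0\<close> by (simp add: pderiv_eq_0_iff)
    \<comment> \<open>Gauss--Lucas for \<open>g\<close>: at positive distance from \<open>K\<close>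
      the lower bound is positive, so \<open>pderiv g\<close> cannot vanish there.\<close>
    have "a \<in> U" if "poly (pderiv g) a = 0" for a
    proof -
      have "infdist a K = 0"
      proof (rule ccontr)
        assume "infdist a K \<noteq> 0"
        then have pos: "infdist a K > 0" using infdist_nonneg[of a K] by simp
        have "diameter K \<ge> 0" using K by (intro diameter_ge_0)
        then have "0 < m * (infdist a K / (diameter K + infdist a K)\<^sup>2)"
          using pos \<open>m > 0\<close> by (intro mult_pos_pos divide_pos_pos zero_less_power) auto
        then show False using lower[OF pos] that by simp
      qed
      then show ?thesis using \<open>\<delta> > 0\<close> by (simp add: U_def)
    qed
    then have "roots_in U (pderiv g) = m - 1"
      using roots_in_eq_degree[OF g'] by (simp add: degree_pderiv deg_g)
    then show ?thesis using g' gh pq by (simp add: A_def roots_in_mult)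
  qed
  ultimately show ?thesis by simp
qed

text \<open>Pigeonhole: the \<open>d + 1\<close> candidates have spacing \<open>c\<close>, so a
  point of \<open>T\<close> is closer than \<open>c / 2\<close> to at most one of them, and
  \<open>T\<close> has at most \<open>d\<close> points.\<close>

lemma exists_separated_point:
  fixes T :: "real set" and x c :: real
  assumes "finite T" "card T \<le> d" "c > 0"
  obtains i :: nat where "i \<le> d" "\<And>t. t \<in> T \<Longrightarrow> c / 2 \<le> \<bar>t - (x + i * c)\<bar>"
proof -
  have "\<exists>i\<le>d. \<forall>t\<in>T. c / 2 \<le> \<bar>t - (x + real i * c)\<bar>"
  proof (rule ccontr)
    assume "\<not> ?thesis"
    then obtain t where t: "\<And>i. i \<le> d \<Longrightarrow> t i \<in> T \<and> \<bar>t i - (x + real i * c)\<bar> < c / 2"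
      by (metis not_le)
    have "inj_on t {..d}"
    proof (rule inj_onI)
      fix i j assume "i \<in> {..d}" "j \<in> {..d}" "t i = t j"
      then have "\<bar>t j - (x + real i * c)\<bar> < c / 2" "\<bar>t j - (x + real j * c)\<bar> < c / 2"
        using t[of i] t[of j] by auto
      then have "\<bar>(real i - real j) * c\<bar> < c" unfolding left_diff_distrib by linarith
      then have "\<bar>real i - real j\<bar> < 1" using assms(3) by (simp add: abs_mult)
      then show "i = j" by linarith
    qed
    then have "card {..d} \<le> card T"
      using t assms(1) by (intro card_inj_on_le) auto
    then show False using assms(2) by simp
  qed
  then show ?thesis using that by blast
qed

lemma roots_in_mono:
  assumes "G \<subseteq> H"
  shows "roots_in G p \<le> roots_in H p"
  unfolding roots_in_def using assms by (intro size_mset_mono filter_mset_mono_strong) auto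

text \<open>The inequality also covers a zero numerator, where the left side is 0 whatever
  \<open>num_zeros\<close> yields.\<close>

lemma roots_in_le_num_zeros: "roots_in G (rf_num f) \<le> num_zeros f G"
proof (cases "rf_num f = 0")
  case True
  then show ?thesis by (simp add: roots_in_def)
next
  case False
  then show ?thesis by (simp add: num_zeros_def roots_in_eq_sum)
qed

section \<open>Choice of the radius and conclusion\<close>

theorem corollary1p2:
  fixes K :: "complex set" and s \<epsilon> :: real and k n :: nat
  assumes "bounded K" and "convex K" and "diameter K = s"
    and "0 < k" and "0 < n" and "k < n"
    and "sqrt (real k) > 4 * (real n - real k)"
    and "\<epsilon> > 0"
    and "\<epsilon> > 4 * s * (real n - real k) / (sqrt (real k) - 4 * (real n - real k))"
  shows "RAGL n k \<epsilon> K"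
  unfolding RAGL_def
proof (intro allI impI)
  fix f :: ratfun
  assume f: "f \<noteq> 0" and n: "num_zeros f UNIV + num_poles f UNIV = n" and k: "k \<le> num_zeros f K"
  define p q where "p = rf_num f" and "q = rf_den f"
  define m d where "m = roots_in K p" and "d = n - k"
  have q: "q \<noteq> 0" using rf_lowest_terms[of f] by (simp add: q_def)
  have p: "p \<noteq> 0" using rf_lowest_terms(1)[of f] f by (auto simp: p_def fract_collapse)
  have "num_zeros f G = roots_in G p" for G
    using p by (simp add: num_zeros_def roots_in_eq_sum p_def)
  moreover have "num_poles f UNIV = roots_in UNIV q"
    using q by (simp add: num_poles_def roots_in_eq_sum q_def)
  ultimately have deg: "degree p + degree q = n" and km: "k \<le> m"
    using n k p q by (simp_all add: roots_in_eq_degree m_def)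
  have m: "m > 0" using km \<open>0 < k\<close> by simp
  then have K: "K \<noteq> {}" by (auto simp: m_def roots_in_def)
  have d: "d > 0" "real n - real k = real d" using \<open>k < n\<close> by (auto simp: d_def)
  have s: "s \<ge> 0" using assms(1,3) diameter_ge_0 by blast
  \<comment> \<open>These are the zeros of \<open>f\<close> outside \<open>K\<close> and the poles
    of \<open>f\<close>, which the frontier has to avoid.\<close>
  define M where "M = filter_mset (\<lambda>a. a \<notin> K) (proots p) + proots q"
  have size_M: "size M = n - m"
  proof -
    have "degree p = roots_in K p + size (filter_mset (\<lambda>a. a \<notin> K) (proots p))"
      unfolding size_proots_complex[symmetric] roots_in_def size_union[symmetric]
      by (rule arg_cong[OF multiset_partition])
    then show ?thesis using deg by (simp add: M_def m_def size_proots_complex)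
  qed
  \<comment> \<open>With this spacing the \<open>d + 1\<close> candidates, starting at
    \<open>\<epsilon> / 2\<close>, end at \<open>3 * \<epsilon> / 4\<close>.\<close>
  define c where "c = \<epsilon> / (4 * d)"
  have c: "c > 0" using d \<open>\<epsilon> > 0\<close> by (simp add: c_def)
  obtain bs where "mset bs = M" using ex_mset by blast
  then have "card ((\<lambda>b. infdist b K) ` set_mset M) \<le> size M"
    using card_length[of "map (\<lambda>b. infdist b K) bs"] by auto
  then have "card ((\<lambda>b. infdist b K) ` set_mset M) \<le> d" using size_M km by (simp add: d_def)
  then obtain i :: nat where i: "i \<le> d" and
    sep: "\<And>t. t \<in> (\<lambda>b. infdist b K) ` set_mset M \<Longrightarrow> c / 2 \<le> \<bar>t - (\<epsilon> / 2 + i * c)\<bar>"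
    using exists_separated_point[OF finite_imageI[OF finite_set_mset] _ c] by metis
  define \<delta> where "\<delta> = \<epsilon> / 2 + i * c"
  have "i * c \<le> d * c" using i c by (intro mult_right_mono) auto
  also have "d * c = \<epsilon> / 4" using d by (simp add: c_def)
  finally have \<delta>: "\<epsilon> / 2 \<le> \<delta>" "\<delta> < \<epsilon>" using c \<open>\<epsilon> > 0\<close> by (auto simp: \<delta>_def)
  \<comment> \<open>The denominator in the hypothesis on \<epsilon> is positive; clearing it and
    squaring gives \<open>k_large\<close>.\<close>
  have "4 * s * d < \<epsilon> * (sqrt k - 4 * d)"
    using assms(7,9) by (simp add: d pos_divide_less_eq)
  then have "4 * d * (s + \<epsilon>) < sqrt k * \<epsilon>" by (simp add: algebra_simps)
  moreover have "0 \<le> 4 * d * (s + \<epsilon>)" using s \<open>\<epsilon> > 0\<close> by simp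
  ultimately have "(4 * d * (s + \<epsilon>))\<^sup>2 < (sqrt k * \<epsilon>)\<^sup>2" by (rule power_strict_mono) simp
  then have k_large: "16 * d\<^sup>2 * (s + \<epsilon>)\<^sup>2 < k * \<epsilon>\<^sup>2" by (simp add: power_mult_distrib)
  have less: "real (n - m) / (c / 2) < m * (\<delta> / (diameter K + \<delta>)\<^sup>2)"
  proof -
    \<comment> \<open>The bound \<open>\<epsilon> / 2 \<le> \<delta>\<close> brings the factor
      \<delta> to the left side, \<open>k_large\<close> then compares the remaining factors, and
      \<open>\<delta> < \<epsilon>\<close> replaces \<open>s + \<epsilon>\<close> by
      \<open>s + \<delta>\<close>.\<close>
    have "real (n - m) / (c / 2) \<le> d / (c / 2)"
      using km c by (intro divide_right_mono) (auto simp: d_def)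
    also have "\<dots> = 16 * d\<^sup>2 * (\<epsilon> / 2) / \<epsilon>\<^sup>2"
      using d \<open>\<epsilon> > 0\<close> by (simp add: c_def field_simps power2_eq_square)
    also have "\<dots> \<le> 16 * d\<^sup>2 * \<delta> / \<epsilon>\<^sup>2"
      using \<delta> by (intro divide_right_mono mult_left_mono) auto
    also have "\<dots> = \<delta> * (16 * d\<^sup>2 / \<epsilon>\<^sup>2)" by simp
    also have "\<dots> < \<delta> * (k / (s + \<epsilon>)\<^sup>2)"
      using k_large s \<delta> \<open>\<epsilon> > 0\<close> by (intro mult_strict_left_mono) (auto simp: divide_simps)
    also have "\<dots> = k * (\<delta> / (s + \<epsilon>)\<^sup>2)" by simp
    also have "\<dots> \<le> m * (\<delta> / (s + \<delta>)\<^sup>2)"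
      using km \<delta> s \<open>\<epsilon> > 0\<close> by (intro mult_mono divide_left_mono power_mono) auto
    finally show ?thesis using assms(3) by simp
  qed
  define U where "U = {z. infdist z K < \<delta>}"
  have "m - 1 + roots_in U q \<le> roots_in U (pderiv p * q - p * pderiv q)"
    unfolding U_def m_def
  proof (rule roots_in_wronskian_ge)
    show "c / 2 \<le> \<bar>infdist b K - \<delta>\<bar>" if "poly p b = 0 \<and> b \<notin> K \<or> poly q b = 0" for b
      using sep[of "infdist b K"] that p q by (auto simp: M_def \<delta>_def)
  qed (use assms(1,2) p q m c \<delta> less deg \<open>\<epsilon> > 0\<close> in \<open>auto simp: m_def\<close>)
  \<comment> \<open>The term \<open>roots_in U q\<close> now stands on both sides and
    cancels.\<close>
  also have "\<dots> \<le> roots_in U (rf_num (rf_deriv f)) + roots_in U q"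
    unfolding p_def q_def by (rule roots_in_wronskian_le)
  finally have "k - 1 \<le> roots_in U (rf_num (rf_deriv f))" using km by linarith
  also have "\<dots> \<le> roots_in (eps_nbhd K \<epsilon>) (rf_num (rf_deriv f))"
    using K \<delta> by (intro roots_in_mono) (auto simp: U_def eps_nbhd_def)
  also have "\<dots> \<le> num_crit f (eps_nbhd K \<epsilon>)"
    unfolding num_crit_def by (rule roots_in_le_num_zeros)
  finally show "k - 1 \<le> num_crit f (eps_nbhd K \<epsilon>)" .
qed

end
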